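(* For every odd positive integer $n$, there are at most $2^{\left\lceil \frac{n}{30}\right\rceil}$ multi-symmetric Steinhaus matrices of size $n$ whose associated Steinhaus graphs are regular modulo $4$.
   Context: A Steinhaus matrix of size $n\geq1$ is a matrix $M=(a_{i,j})_{1\leq i,j\leq n}$ with entries in $\mathbb{F}_2=\{0,1\}$ such that $a_{i,i}=0$ for all $i$, $a_{i,j}=a_{i-1,j-1}+a_{i-1,j}$ (addition in $\mathbb{F}_2$) for all $2\leq i<j\leq n$, and $a_{i,j}=a_{j,i}$ for all $i,j$. The associated Steinhaus graph is the simple graph on vertices $V_1,\ldots,V_n$ with adjacency matrix $M$. A graph is regular modulo $4$ if all its vertex degrees are congruent modulo $4$. A square matrix $(a_{i,j})$ of size $n$ is doubly-symmetric if $a_{i,j}=a_{j,i}=a_{n-j+1,n-i+1}$ for all $i,j$; it is multi-symmetric if it is doubly-symmetric and $a_{i,j}=a_{i,n-j+i+1}$ for all $1\leq i<j\leq n$. *)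

theory Defs
  imports
    Complex_Main
    "HOL-Library.Z2"
    "HOL-Number_Theory.Cong"
    "Jordan_Normal_Form.Matrix"
    "Graph_Theory.Pair_Digraph"
begin

text \<open>Matrices are indexed from 0 in the library; \<open>ent M i j\<close> is the entry in row \<open>i\<close> and
  column \<open>j\<close> counted from 1. It is meaningful only for indices between 1 and the size.\<close>

abbreviation ent :: "'a mat \<Rightarrow> nat \<Rightarrow> nat \<Rightarrow> 'a" where
  "ent M i j \<equiv> M $$ (i - 1, j - 1)"

definition steinhaus_matrix :: "nat \<Rightarrow> bit mat \<Rightarrow> bool" where
  "steinhaus_matrix n M \<longleftrightarrow>
     n \<ge> 1 \<and> M \<in> carrier_mat n n \<and>
     (\<forall>i\<in>{1..n}. ent M i i = 0) \<and>
     (\<forall>i j. 2 \<le> i \<and> i < j \<and> j \<le> n \<longrightarrow> ent M i j = ent M (i - 1) (j - 1) + ent M (i - 1) j) \<and>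
     (\<forall>i\<in>{1..n}. \<forall>j\<in>{1..n}. ent M i j = ent M j i)"

definition doubly_symmetric :: "nat \<Rightarrow> 'a mat \<Rightarrow> bool" where
  "doubly_symmetric n M \<longleftrightarrow>
     M \<in> carrier_mat n n \<and>
     (\<forall>i\<in>{1..n}. \<forall>j\<in>{1..n}.
        ent M i j = ent M j i \<and> ent M j i = ent M (n - j + 1) (n - i + 1))"

definition multi_symmetric :: "nat \<Rightarrow> 'a mat \<Rightarrow> bool" where
  "multi_symmetric n M \<longleftrightarrow>
     doubly_symmetric n M \<and>
     (\<forall>i j. 1 \<le> i \<and> i < j \<and> j \<le> n \<longrightarrow> ent M i j = ent M i (n - j + i + 1))"

text \<open>Simple graphs are loop-free symmetric digraphs on pairs (\<open>pair_graph\<close>): an edge between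
  \<open>u\<close> and \<open>v\<close> is the pair of arcs \<open>(u, v)\<close>, \<open>(v, u)\<close>, so the degree of a vertex is its
  out-degree. The vertex \<open>V\<^sub>i\<close> is the number \<open>i\<close>.\<close>

definition steinhaus_graph :: "nat \<Rightarrow> bit mat \<Rightarrow> nat pair_pre_digraph" where
  "steinhaus_graph n M =
     \<lparr> pverts = {1..n}, parcs = {(i, j). i \<in> {1..n} \<and> j \<in> {1..n} \<and> ent M i j = 1} \<rparr>"

lemma pair_graph_steinhaus_graph:
  assumes "steinhaus_matrix n M"
  shows "pair_graph (steinhaus_graph n M)"
proof -
  have diag: "\<And>i. i \<in> {1..n} \<Longrightarrow> ent M i i = 0"
    and symm: "\<And>i j. i \<in> {1..n} \<Longrightarrow> j \<in> {1..n} \<Longrightarrow> ent M i j = ent M j i"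
    using assms unfolding steinhaus_matrix_def by blast+
  have "finite {(i, j). i \<in> {1..n} \<and> j \<in> {1..n} \<and> ent M i j = 1}"
    by (rule finite_subset[of _ "{1..n} \<times> {1..n}"]) auto
  then show ?thesis
    using diag symm
    by unfold_locales (auto simp: steinhaus_graph_def symmetric_def sym_def)
qed

definition regular_modulo :: "nat \<Rightarrow> 'a pair_pre_digraph \<Rightarrow> bool" where
  "regular_modulo m G \<longleftrightarrow>
     (\<forall>u\<in>pverts G. \<forall>v\<in>pverts G.
        [out_degree (with_proj G) u = out_degree (with_proj G) v] (mod m))"

end

theory Submission
  imports Defs
begin

text \<open>
  Index the entries above the diagonal by triples of sum \<open>d = n - 2\<close>. The Steinhaus rule makes
  \<open>T x y z\<close> a linear functional on the monomials \<open>X\<^sup>x Y\<^sup>y Z\<^sup>z\<close> modulo \<open>X + Y + Z\<close> over the field with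
  two elements, and multi-symmetry is invariance under all permutations of \<open>X, Y, Z\<close>. Rows are
  palindromes, with zero centre when their length is odd, so a degree is twice a sum of two half rows; half rows telescope,
  and regularity modulo 4 becomes the linear condition \<open>balanced\<close>.

  For odd \<open>d = 2 h + 1\<close> this condition forces the all-odd entries to vanish, and the rest is a
  balanced triangle of degree \<open>h + 1\<close>. For even \<open>d = 2 K\<close> let \<open>g\<^sub>j\<close> be the central entry of the row
  \<open>x = 2 K - 2 j - 1\<close>. Expanding the entry \<open>y = 1\<close> of a row in the \<open>g\<^sub>j\<close> and comparing with
  balancedness gives, for each \<open>k < K\<close>, the relation that the \<open>g\<^sub>j\<close> with \<open>j < k\<close>, weighted by
  \<open>2 k - 1 - j\<close> choose \<open>j - 1\<close>, sum to \<open>0\<close>. Modulo 2 these relations express \<open>g\<^sub>j\<close> by the earlier ones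
  unless \<open>j\<close> is \<open>0\<close>, \<open>7\<close>, \<open>12\<close> or \<open>15\<close> modulo 16. By symmetry the \<open>g\<^sub>j\<close> with \<open>2 j < K\<close> already determine
  the triangle, which leaves at most \<open>K div 8\<close> parameters.
\<close>

declare add_bit_eq_xor [simp del] mult_bit_eq_and [simp del]

lemma bit_add_self [simp]: "a + a = 0" for a :: bit
  by (cases a) simp_all

lemma bit_add_left_cancel_self [simp]: "a + (a + b) = b" for a b :: bit
  by (cases a) simp_all

lemma bit_add_eq_0_iff: "a + b = 0 \<longleftrightarrow> a = b" for a b :: bit
  by (cases a; cases b) simp_all

section \<open>Binomial coefficients modulo 2\<close>

text \<open>Lucas' theorem for the prime 2, one binary digit at a time. Two steps of Pascal's rule
  lead from row \<open>2 * n\<close> to row \<open>2 * n + 2\<close>, and the doubled middle term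
  vanishes.\<close>

lemma of_nat_choose_double:
  shows "(of_nat ((2 * n) choose (2 * k)) :: bit) = of_nat (n choose k)"
    and "(of_nat (Suc (2 * n) choose (2 * k)) :: bit) = of_nat (n choose k)"
    and "(of_nat ((2 * n) choose Suc (2 * k)) :: bit) = 0"
    and "(of_nat (Suc (2 * n) choose Suc (2 * k)) :: bit) = of_nat (n choose k)"
proof -
  have "(\<forall>k. (of_nat ((2 * n) choose (2 * k)) :: bit) = of_nat (n choose k)) \<and>
        (\<forall>k. (of_nat ((2 * n) choose Suc (2 * k)) :: bit) = 0)" for n
  proof (induction n)
    case 0
    have "(of_nat (0 choose (2 * k)) :: bit) = of_nat (0 choose k)" for k :: nat
      by (cases k) simp_all
    then show ?case by simp
  next
    case (Suc n)
    have "(of_nat ((2 * Suc n) choose (2 * k)) :: bit) = of_nat (Suc n choose k)" for k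
      using Suc[THEN conjunct1, rule_format, of k] Suc[THEN conjunct1, rule_format, of "k - 1"]
        Suc[THEN conjunct2, rule_format, of "k - 1"]
      by (cases k) (simp_all add: add_ac)
    moreover have "(of_nat ((2 * Suc n) choose Suc (2 * k)) :: bit) = 0" for k
      using Suc[THEN conjunct1, rule_format, of k] Suc[THEN conjunct2, rule_format, of k]
        Suc[THEN conjunct2, rule_format, of "k - 1"]
      by (cases k) (simp_all add: add_ac)
    ultimately show ?case by blast
  qed
  note * = this[THEN conjunct1, rule_format] this[THEN conjunct2, rule_format]
  show "(of_nat ((2 * n) choose (2 * k)) :: bit) = of_nat (n choose k)"
    and "(of_nat ((2 * n) choose Suc (2 * k)) :: bit) = 0"
    by (rule *)+
  show "(of_nat (Suc (2 * n) choose (2 * k)) :: bit) = of_nat (n choose k)"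
    using *(1)[of n k] *(2)[of n "k - 1"] by (cases k) simp_all
  show "(of_nat (Suc (2 * n) choose Suc (2 * k)) :: bit) = of_nat (n choose k)"
    using *(1)[of n k] *(2)[of n k] by simp
qed

lemma of_nat_choose_halve:
  assumes "even k"
  shows "(of_nat (n choose k) :: bit) = of_nat (n div 2 choose (k div 2))"
  using assms of_nat_choose_double(1,2)[of "n div 2" "k div 2"]
  by (cases "even n") (simp_all add: odd_two_times_div_two_succ)

lemma of_nat_choose_two: "(of_nat (n choose 2) :: bit) = of_nat (n div 2)"
  by (simp add: of_nat_choose_halve)

lemma of_nat_choose_four: "(of_nat (n choose 4) :: bit) = of_nat (n div 4)"
  by (simp add: of_nat_choose_halve div_mult2_eq[symmetric])

lemma of_nat_choose_eight: "(of_nat (n choose 8) :: bit) = of_nat (n div 8)"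
  by (simp add: of_nat_choose_halve div_mult2_eq[symmetric])

text \<open>Six is 110 in binary, so the parity is the product of the binary digits of
  \<open>n\<close> of weights 2 and 4.\<close>

lemma of_nat_choose_six: "(of_nat (n choose 6) :: bit) = of_nat (n div 2) * of_nat (n div 4)"
proof -
  define m where "m = n div 2"
  have "(of_nat (m choose Suc (2 * 1)) :: bit) = of_nat m * of_nat (m div 2)"
  proof (cases "even m")
    case True
    then show ?thesis using of_nat_choose_double(3)[of "m div 2" 1] by (auto elim!: evenE)
  next
    case False
    then show ?thesis using of_nat_choose_double(4)[of "m div 2" 1] by (auto elim!: oddE)
  qed
  then show ?thesis
    by (simp add: of_nat_choose_halve m_def div_mult2_eq[symmetric] numeral_3_eq_3)
qed

lemma of_nat_bit: "(of_nat n :: bit) = of_bool (odd n)"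
  by (induction n) auto

section \<open>Steinhaus triangles with dihedral symmetry\<close>

text \<open>Only the values with \<open>x + y + z = d\<close> matter; outside this range \<open>T\<close> is arbitrary.\<close>

definition dihedral :: "nat \<Rightarrow> (nat \<Rightarrow> nat \<Rightarrow> nat \<Rightarrow> bit) \<Rightarrow> bool" where
  "dihedral d T \<longleftrightarrow>
     (\<forall>x y z. x + y + z + 1 = d \<longrightarrow> T (Suc x) y z = T x (Suc y) z + T x y (Suc z)) \<and>
     (\<forall>x y z. x + y + z = d \<longrightarrow> T x y z = T y x z \<and> T x y z = T x z y)"

text \<open>Regularity modulo 4, translated to triangles. The two halves of \<open>k + 1\<close>
  differ by at most 1, so the right-hand side adds central entries of the rows \<open>i\<close> and
  \<open>k\<close>.\<close>

definition balanced :: "nat \<Rightarrow> (nat \<Rightarrow> nat \<Rightarrow> nat \<Rightarrow> bit) \<Rightarrow> bool" where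
  "balanced d T \<longleftrightarrow> dihedral d T \<and>
     (\<forall>i k. i + k + 1 = d \<longrightarrow>
        T 1 i k = T i ((k + 1) div 2) ((k + 2) div 2) + T k ((i + 1) div 2) ((i + 2) div 2))"

lemma dihedral_step:
  assumes "dihedral d T" "x + y + z + 1 = d"
  shows "T (Suc x) y z = T x (Suc y) z + T x y (Suc z)"
  using assms unfolding dihedral_def by blast

lemma dihedral_swap12:
  assumes "dihedral d T" "x + y + z = d"
  shows "T x y z = T y x z"
  using assms unfolding dihedral_def by blast

lemma dihedral_swap23:
  assumes "dihedral d T" "x + y + z = d"
  shows "T x y z = T x z y"
  using assms unfolding dihedral_def by blast

lemma dihedral_swap13:
  assumes "dihedral d T" "x + y + z = d"
  shows "T x y z = T z y x"
  using dihedral_swap12[OF assms] dihedral_swap23[OF assms(1), of y x z]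
    dihedral_swap12[OF assms(1), of y z x] assms(2) by simp

text \<open>The two entries above a centre are mirror images and cancel. The top row has nothing
  above it, hence \<open>x > 0\<close>.\<close>

lemma dihedral_center:
  assumes "dihedral d T" "x + y + y = d" "x > 0"
  shows "T x y y = 0"
proof -
  have "T (Suc (x - 1)) y y = T (x - 1) (Suc y) y + T (x - 1) y (Suc y)"
    using assms by (intro dihedral_step) auto
  with dihedral_swap23[OF assms(1), of "x - 1" "Suc y" y] assms show ?thesis by simp
qed

text \<open>Squaring X = Y + Z in characteristic 2 gives X^2 = Y^2 + Z^2.\<close>

lemma dihedral_step_two:
  assumes "dihedral d T" "x + y + z + 2 = d"
  shows "T (x + 2) y z = T x (y + 2) z + T x y (z + 2)"
  using dihedral_step[OF assms(1), of "x + 1" y z] dihedral_step[OF assms(1), of x "y + 1" z]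
    dihedral_step[OF assms(1), of x y "z + 1"] assms(2)
  by (simp add: ac_simps)

lemma dihedral_zero_if_top_row_zero:
  assumes "dihedral d T" "\<And>y z. y + z = d \<Longrightarrow> T 0 y z = 0"
  shows "x + y + z = d \<Longrightarrow> T x y z = 0"
proof (induction x arbitrary: y z)
  case (Suc x)
  then show ?case using dihedral_step[OF assms(1), of x y z] by simp
qed (use assms(2) in simp)

lemma balanced_dihedral: "balanced d T \<Longrightarrow> dihedral d T"
  by (simp add: balanced_def)

lemma balanced_row:
  assumes "balanced d T" "i + k + 1 = d"
  shows "T 1 i k = T i ((k + 1) div 2) ((k + 2) div 2) + T k ((i + 1) div 2) ((i + 2) div 2)"
  using assms unfolding balanced_def by blast

lemma balanced_add:
  assumes "balanced d T" "balanced d T'"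
  shows "balanced d (\<lambda>x y z. T x y z + T' x y z)"
  unfolding balanced_def dihedral_def
proof (intro conjI allI impI)
  fix x y z :: nat assume "x + y + z + 1 = d"
  then show "T (Suc x) y z + T' (Suc x) y z =
      T x (Suc y) z + T' x (Suc y) z + (T x y (Suc z) + T' x y (Suc z))"
    by (simp add: dihedral_step[OF balanced_dihedral[OF assms(1)]]
        dihedral_step[OF balanced_dihedral[OF assms(2)]] add_ac)
next
  fix x y z :: nat assume s: "x + y + z = d"
  show "T x y z + T' x y z = T y x z + T' y x z"
    using dihedral_swap12[OF balanced_dihedral[OF assms(1)] s]
      dihedral_swap12[OF balanced_dihedral[OF assms(2)] s] by simp
  show "T x y z + T' x y z = T x z y + T' x z y"
    using dihedral_swap23[OF balanced_dihedral[OF assms(1)] s]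
      dihedral_swap23[OF balanced_dihedral[OF assms(2)] s] by simp
next
  fix i k :: nat assume s: "i + k + 1 = d"
  show "T 1 i k + T' 1 i k =
      T i ((k + 1) div 2) ((k + 2) div 2) + T' i ((k + 1) div 2) ((k + 2) div 2) +
      (T k ((i + 1) div 2) ((i + 2) div 2) + T' k ((i + 1) div 2) ((i + 2) div 2))"
    unfolding balanced_row[OF assms(1) s] balanced_row[OF assms(2) s] by (simp only: add_ac)
qed

section \<open>Triangles of odd degree\<close>

text \<open>The functional \<open>F \<mapsto> T (X F\<^sup>2)\<close>, evaluated at \<open>X F\<close>. On overlaps the branches agree for balanced
  triangles because their all-odd entries vanish.\<close>

definition halved :: "(nat \<Rightarrow> nat \<Rightarrow> nat \<Rightarrow> bit) \<Rightarrow> nat \<Rightarrow> nat \<Rightarrow> nat \<Rightarrow> bit" where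
  "halved T x y z =
     (if x > 0 then T (2 * x - 1) (2 * y) (2 * z)
      else if y > 0 then T (2 * x) (2 * y - 1) (2 * z)
      else T (2 * x) (2 * y) (2 * z - 1))"

context
  fixes h :: nat and T :: "nat \<Rightarrow> nat \<Rightarrow> nat \<Rightarrow> bit"
  assumes bal: "balanced (2 * h + 1) T"
begin

private lemmas odd_dih = balanced_dihedral[OF bal]

text \<open>In row 1, balancedness yields two exact centres, which vanish. The squared Steinhaus
  rule carries this to row \<open>x\<close> in steps of 2 that preserve all parities.\<close>

lemma balanced_odd_entries_zero:
  assumes "odd x" "odd y" "odd z" "x + y + z = 2 * h + 1"
  shows "T x y z = 0"
  using assms
proof (induction x arbitrary: y z rule: less_induct)
  case (less x)
  show ?case
  proof (cases "x = 1")
    case True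
    from less.prems obtain a b where ab: "y = 2 * a + 1" "z = 2 * b + 1" by (auto elim!: oddE)
    have "T 1 y z = T y (b + 1) (b + 1) + T z (a + 1) (a + 1)"
      using balanced_row[OF bal, of y z] less.prems(4) True ab by simp
    moreover have "T y (b + 1) (b + 1) = 0" "T z (a + 1) (a + 1) = 0"
      using less.prems(4) True ab by (auto intro!: dihedral_center[OF odd_dih])
    ultimately show ?thesis using True by simp
  next
    case False
    then have "x = (x - 2) + 2" "odd (x - 2)" using less.prems(1) by presburger+
    then obtain w where w: "x = w + 2" "odd w" by blast
    have "T w (y + 2) z = 0" "T w y (z + 2) = 0"
      using less.prems w by (auto intro!: less.IH)
    then show ?thesis
      using dihedral_step_two[OF odd_dih, of w y z] less.prems(4) w by simp
  qed
qed

lemma halved_first: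
  assumes "x > 0" "x + y + z = h + 1"
  shows "halved T x y z = T (2 * x - 1) (2 * y) (2 * z)"
  using assms by (simp add: halved_def)

lemma halved_second:
  assumes "y > 0" "x + y + z = h + 1"
  shows "halved T x y z = T (2 * x) (2 * y - 1) (2 * z)"
proof (cases "x > 0")
  case True
  have "T (Suc (2 * x - 1)) (2 * y - 1) (2 * z) =
      T (2 * x - 1) (Suc (2 * y - 1)) (2 * z) + T (2 * x - 1) (2 * y - 1) (Suc (2 * z))"
    using assms True by (intro dihedral_step[OF odd_dih]) auto
  moreover have "T (2 * x - 1) (2 * y - 1) (Suc (2 * z)) = 0"
    using assms True by (intro balanced_odd_entries_zero) auto
  ultimately show ?thesis using assms True by (simp add: halved_def)
qed (use assms in \<open>simp add: halved_def\<close>)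

lemma halved_third:
  assumes "z > 0" "x + y + z = h + 1"
  shows "halved T x y z = T (2 * x) (2 * y) (2 * z - 1)"
proof (cases "x > 0")
  case True
  have "T (Suc (2 * x - 1)) (2 * y) (2 * z - 1) =
      T (2 * x - 1) (Suc (2 * y)) (2 * z - 1) + T (2 * x - 1) (2 * y) (Suc (2 * z - 1))"
    using assms True by (intro dihedral_step[OF odd_dih]) auto
  moreover have "T (2 * x - 1) (Suc (2 * y)) (2 * z - 1) = 0"
    using assms True by (intro balanced_odd_entries_zero) auto
  ultimately show ?thesis using assms True by (simp add: halved_def)
next
  case x: False
  show ?thesis
  proof (cases "y > 0")
    case True
    have "T 0 (2 * y - 1) (2 * z) = T 0 (2 * y) (2 * z - 1)"
      using dihedral_step[OF odd_dih, of 0 "2 * y - 1" "2 * z - 1"] assms True x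
        balanced_odd_entries_zero[of 1 "2 * y - 1" "2 * z - 1"]
      by (simp add: bit_add_eq_0_iff)
    then show ?thesis using x True by (simp add: halved_def)
  qed (use x in \<open>simp add: halved_def\<close>)
qed

text \<open>The Steinhaus rule of \<open>T\<close> at \<open>2 * x\<close>, \<open>2 * y\<close>,
  \<open>2 * z\<close> raises one coordinate in each term, so its three terms are read by the three
  branches of \<open>halved\<close>.\<close>

lemma dihedral_halved: "dihedral (h + 1) (halved T)"
  unfolding dihedral_def
proof (intro conjI allI impI)
  fix x y z :: nat assume "x + y + z + 1 = h + 1"
  then show "halved T (Suc x) y z = halved T x (Suc y) z + halved T x y (Suc z)"
    using dihedral_step[OF odd_dih, of "2 * x" "2 * y" "2 * z"]
    by (simp add: halved_first halved_second halved_third)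
next
  fix x y z :: nat assume s: "x + y + z = h + 1"
  then consider "x > 0" | "y > 0" | "z > 0" by linarith
  note pos = this
  from pos show "halved T x y z = halved T y x z"
  proof cases
    case 1
    then show ?thesis using s dihedral_swap12[OF odd_dih, of "2 * x - 1" "2 * y" "2 * z"]
      by (simp add: halved_first halved_second)
  next
    case 2
    then show ?thesis using s dihedral_swap12[OF odd_dih, of "2 * x" "2 * y - 1" "2 * z"]
      by (simp add: halved_first halved_second)
  next
    case 3
    then show ?thesis using s dihedral_swap12[OF odd_dih, of "2 * x" "2 * y" "2 * z - 1"]
      by (simp add: halved_third)
  qed
  from pos show "halved T x y z = halved T x z y"
  proof cases
    case 1
    then show ?thesis using s dihedral_swap23[OF odd_dih, of "2 * x - 1" "2 * y" "2 * z"]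
      by (simp add: halved_first)
  next
    case 2
    then show ?thesis using s dihedral_swap23[OF odd_dih, of "2 * x" "2 * y - 1" "2 * z"]
      by (simp add: halved_second halved_third)
  next
    case 3
    then show ?thesis using s dihedral_swap23[OF odd_dih, of "2 * x" "2 * y" "2 * z - 1"]
      by (simp add: halved_second halved_third)
  qed
qed

text \<open>Balancedness of \<open>T\<close> is used at the even pair \<open>2 * i\<close>,
  \<open>2 * k\<close>. The central entries met there end in consecutive numbers, just one of them
  odd, so they are again central values of \<open>halved T\<close>.\<close>

lemma balanced_halved: "balanced (h + 1) (halved T)"
proof -
  have center: "T (2 * i) k (k + 1) = halved T i ((k + 1) div 2) ((k + 2) div 2)"
    if "i + k = h" for i k
  proof (cases "even k")
    case True
    then show ?thesis using that by (auto simp: halved_third elim!: evenE)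
  next
    case False
    then show ?thesis using that by (auto simp: halved_second elim!: oddE)
  qed
  have "halved T 1 i k =
      halved T i ((k + 1) div 2) ((k + 2) div 2) + halved T k ((i + 1) div 2) ((i + 2) div 2)"
    if "i + k = h" for i k
  proof -
    have "halved T 1 i k = T 1 (2 * i) (2 * k)" using that by (simp add: halved_first)
    also have "\<dots> = T (2 * i) k (k + 1) + T (2 * k) i (i + 1)"
      using that balanced_row[OF bal, of "2 * i" "2 * k"] by simp
    finally show ?thesis using that center[of i k] center[of k i] by simp
  qed
  then show ?thesis using dihedral_halved by (simp add: balanced_def)
qed

text \<open>As the degree is odd, one or three coordinates are odd. Three give 0, and one gives a
  value of \<open>halved T\<close>.\<close>

lemma zero_if_halved_zero:
  assumes zero: "\<And>x y z. x + y + z = h + 1 \<Longrightarrow> halved T x y z = 0" and "x + y + z = 2 * h + 1"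
  shows "T x y z = 0"
proof -
  have "odd (x + y + z)" using assms(2) by simp
  then consider "odd x" "odd y" "odd z" | "odd x" "even y" "even z" | "even x" "odd y" "even z"
    | "even x" "even y" "odd z"
    unfolding even_add by blast
  then show ?thesis
  proof cases
    case 1
    then show ?thesis using assms(2) by (rule balanced_odd_entries_zero)
  next
    case 2
    then obtain a b c where "x = 2 * a + 1" "y = 2 * b" "z = 2 * c" by (auto elim!: evenE oddE)
    then show ?thesis using assms(2) zero[of "a + 1" b c] by (simp add: halved_first)
  next
    case 3
    then obtain a b c where "x = 2 * a" "y = 2 * b + 1" "z = 2 * c" by (auto elim!: evenE oddE)
    then show ?thesis using assms(2) zero[of a "b + 1" c] by (simp add: halved_second)
  next
    case 4
    then obtain a b c where "x = 2 * a" "y = 2 * b" "z = 2 * c + 1" by (auto elim!: evenE oddE)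
    then show ?thesis using assms(2) zero[of a b "c + 1"] by (simp add: halved_third)
  qed
qed

end

section \<open>Triangles of even degree\<close>

context
  fixes K :: nat and T :: "nat \<Rightarrow> nat \<Rightarrow> nat \<Rightarrow> bit"
  assumes bal: "balanced (2 * K) T"
begin

private lemmas even_dih = balanced_dihedral[OF bal]

text \<open>These are the g of the overview. Such a row has even length \<open>2 * j + 2\<close>,
  and its two central entries coincide.\<close>

definition axis_entry :: "nat \<Rightarrow> bit" where
  "axis_entry j = T (2 * K - 2 * j - 1) j (j + 1)"

text \<open>\<open>q\<close> measures the distance from the axis. Solved for the outer entry, the
  Steinhaus rule expresses distance \<open>q\<close> by distances \<open>q - 1\<close> and
  \<open>q - 2\<close>. This is the Fibonacci polynomial recursion, whose coefficients are these
  binomials.\<close>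

lemma entry_eq_sum_axis_entries:
  assumes "2 * s + q < 2 * K"
  shows "T (2 * K - 2 * s - q) s (s + q) =
    (\<Sum>i<q. of_nat ((q - 1 - i) choose i) * axis_entry (s + i))"
  using assms
proof (induction q arbitrary: s rule: less_induct)
  case (less q)
  consider "q = 0" | "q = 1" | p where "q = p + 2"
    by (metis One_nat_def add_2_eq_Suc' not0_implies_Suc)
  then show ?case
  proof cases
    case 1
    then show ?thesis using less.prems by (auto intro!: dihedral_center[OF even_dih])
  next
    case 2
    then show ?thesis by (simp add: axis_entry_def)
  next
    case 3
    define k where "k = 2 * K - 2 * s - q"
    have k: "k + 2 * s + q = 2 * K" "k > 0" using less.prems by (auto simp: k_def)
    have "T (Suc k) s (s + p + 1) = T k (Suc s) (s + p + 1) + T k s (Suc (s + p + 1))"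
      using k 3 by (intro dihedral_step[OF even_dih]) auto
    then have "T k s (s + q) = T (Suc k) s (s + (p + 1)) + T k (s + 1) (s + 1 + p)"
      using 3 by (simp add: add_ac)
    also have "T (Suc k) s (s + (p + 1)) =
        (\<Sum>i<p + 1. of_nat ((p + 1 - 1 - i) choose i) * axis_entry (s + i))"
      using less.IH[of "p + 1" s] k 3 by (simp add: k_def Suc_diff_Suc)
    also have "\<dots> = axis_entry s +
        (\<Sum>i<p. of_nat ((p - 1 - i) choose Suc i) * axis_entry (s + 1 + i))"
      by (simp add: sum.lessThan_Suc_shift del: sum.lessThan_Suc)
    also have "T k (s + 1) (s + 1 + p) =
        (\<Sum>i<p. of_nat ((p - 1 - i) choose i) * axis_entry (s + 1 + i))"
      using less.IH[of p "s + 1"] k 3 by (simp add: k_def)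
    also have "axis_entry s +
        (\<Sum>i<p. of_nat ((p - 1 - i) choose Suc i) * axis_entry (s + 1 + i)) +
        (\<Sum>i<p. of_nat ((p - 1 - i) choose i) * axis_entry (s + 1 + i)) =
        axis_entry s + (\<Sum>i<p. of_nat ((p - i) choose Suc i) * axis_entry (s + 1 + i))"
    proof -
      have "of_nat ((p - 1 - i) choose Suc i) * a + of_nat ((p - 1 - i) choose i) * a =
          of_nat ((p - i) choose Suc i) * a" if "i < p" for i and a :: bit
      proof -
        have "p - i = Suc (p - 1 - i)" using that by simp
        then show ?thesis by (simp only: binomial_Suc_Suc of_nat_add distrib_right add_ac)
      qed
      then show ?thesis by (simp add: sum.distrib[symmetric] add.assoc)
    qed
    also have "\<dots> = (\<Sum>i<q. of_nat ((q - 1 - i) choose i) * axis_entry (s + i))"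
      using 3 by (simp add: sum.lessThan_Suc_shift[of _ "Suc p"] del: sum.lessThan_Suc)
         (simp add: add_ac)
    finally show ?thesis by (simp add: k_def)
  qed
qed

text \<open>Balancedness for \<open>i = 2 * j\<close> involves two central entries: this one and an
  exact centre, which vanishes.\<close>

lemma axis_entry_eq_second_row:
  assumes "j \<ge> 1" "j < K"
  shows "axis_entry j = T 1 (2 * j) (2 * K - 2 * j - 1)"
proof -
  have "T 1 (2 * j) (2 * K - 2 * j - 1) = T (2 * j) (K - j) (K - j) + axis_entry j"
  proof -
    have "(2 * K - 2 * j - 1 + 1) div 2 = K - j" "(2 * K - 2 * j - 1 + 2) div 2 = K - j"
      "(2 * j + 1) div 2 = j" "(2 * j + 2) div 2 = j + 1"
      using assms by linarith+
    then show ?thesis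
      using balanced_row[OF bal, of "2 * j" "2 * K - 2 * j - 1"] assms
      by (simp only: axis_entry_def) simp
  qed
  also have "T (2 * j) (K - j) (K - j) = 0"
    using assms by (intro dihedral_center[OF even_dih]) auto
  finally show ?thesis by simp
qed

text \<open>The entry of row 1 equal to \<open>axis_entry k\<close> is moved by symmetry into the
  row of \<open>axis_entry k\<close>, at \<open>y = 1\<close>. Its expansion contains
  \<open>axis_entry k\<close> once, which cancels and leaves a relation among earlier
  entries.\<close>

lemma axis_entry_relation:
  assumes "k \<ge> 1" "k < K"
  shows "(\<Sum>i<k - 1. of_nat ((2 * k - 2 - i) choose i) * axis_entry (Suc i)) = 0"
proof -
  have "T (2 * K - 2 * k - 1) 1 (2 * k) = T 1 (2 * k) (2 * K - 2 * k - 1)"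
    using dihedral_swap12[OF even_dih, of "2 * K - 2 * k - 1" 1 "2 * k"]
      dihedral_swap23[OF even_dih, of 1 "2 * K - 2 * k - 1" "2 * k"] assms by simp
  then have "axis_entry k = T (2 * K - 2 * 1 - (2 * k - 1)) 1 (1 + (2 * k - 1))"
    using axis_entry_eq_second_row[OF assms] assms by (simp add: numeral_2_eq_2)
  also have "\<dots> = (\<Sum>i<2 * k - 1. of_nat ((2 * k - 1 - 1 - i) choose i) * axis_entry (1 + i))"
    using assms by (intro entry_eq_sum_axis_entries) auto
  also have "\<dots> = (\<Sum>i<k. of_nat ((2 * k - 1 - 1 - i) choose i) * axis_entry (1 + i))"
    using assms by (intro sum.mono_neutral_right) (auto simp: binomial_eq_0)
  also have "\<dots> = (\<Sum>i<Suc (k - 1). of_nat ((2 * k - 2 - i) choose i) * axis_entry (Suc i))"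
    using assms by (simp add: numeral_2_eq_2)
  \<comment> \<open>The last summand has coefficient \<open>(k - 1) choose (k - 1)\<close>, which is
    1.\<close>
  also have "\<dots> = (\<Sum>i<k - 1. of_nat ((2 * k - 2 - i) choose i) * axis_entry (Suc i)) + axis_entry k"
  proof -
    have "2 * k - 2 - (k - 1) = k - 1" by simp
    then show ?thesis using assms by (simp only: sum.lessThan_Suc) simp
  qed
  finally show ?thesis by (metis add_left_imp_eq add.right_neutral add.commute)
qed

text \<open>This is the relation for \<open>k = j + w\<close>. Binomial symmetry makes the lower
  indices independent of \<open>j\<close>, so that parities depend only on \<open>j\<close> modulo a
  power of 2.\<close>

lemma axis_entry_relation_tail:
  assumes "j \<ge> 1" "j + w < K" and zero: "\<And>i. 1 \<le> i \<Longrightarrow> i < j \<Longrightarrow> axis_entry i = 0"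
  shows "(\<Sum>t<w. of_nat ((j + 2 * w - 1 - t) choose (2 * w - 2 * t)) * axis_entry (j + t)) = 0"
proof -
  let ?f = "\<lambda>i. of_nat ((2 * (j + w) - 2 - i) choose i) * axis_entry (Suc i)"
  have "(\<Sum>i<j + w - 1. ?f i) = (\<Sum>i\<in>{j - 1..<j + w - 1}. ?f i)"
    using assms(1) by (intro sum.mono_neutral_right) (auto intro!: zero)
  also have "\<dots> = (\<Sum>t<w. ?f (j - 1 + t))"
    using assms(1) sum.shift_bounds_nat_ivl[of ?f 0 "j - 1" w]
    by (simp add: atLeast0LessThan add_ac)
  also have "\<dots> =
      (\<Sum>t<w. of_nat ((j + 2 * w - 1 - t) choose (2 * w - 2 * t)) * axis_entry (j + t))"
  proof (rule sum.cong)
    fix t assume t: "t \<in> {..<w}"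
    have "(j + 2 * w - 1 - t) choose (j - 1 + t) = (j + 2 * w - 1 - t) choose (2 * w - 2 * t)"
    proof -
      have "j - 1 + t \<le> j + 2 * w - 1 - t" "j + 2 * w - 1 - t - (j - 1 + t) = 2 * w - 2 * t"
        using t assms(1) by auto
      then show ?thesis using binomial_symmetric by metis
    qed
    moreover have "2 * (j + w) - 2 - (j - 1 + t) = j + 2 * w - 1 - t" "Suc (j - 1 + t) = j + t"
      using assms(1) by simp_all
    ultimately show "?f (j - 1 + t) =
        of_nat ((j + 2 * w - 1 - t) choose (2 * w - 2 * t)) * axis_entry (j + t)" by simp
  qed simp
  finally show ?thesis using axis_entry_relation[of "j + w"] assms by simp
qed

text \<open>The largest lower index used is 8, and the parity of \<open>n choose 8\<close> depends
  on \<open>n\<close> modulo 16; hence the modulus.\<close>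

lemma axis_entry_zero:
  assumes j: "j \<ge> 1" "2 * j < K" "j mod 16 \<notin> {0, 7, 12, 15}"
    and zero: "\<And>i. 1 \<le> i \<Longrightarrow> i < j \<Longrightarrow> axis_entry i = 0"
  shows "axis_entry j = 0"
proof -
  note tail = axis_entry_relation_tail[OF j(1) _ zero]
  note coeffs = of_nat_choose_two of_nat_choose_four of_nat_choose_six of_nat_choose_eight
  \<comment> \<open>The coefficient of \<open>g\<^sub>j\<close> is odd in the relation for \<open>k = j + 1\<close>, \<open>j + 2\<close>, \<open>j + 4\<close> respectively and
    those of its successors are even, except in the last case, where the relation for \<open>k = j + 3\<close>
    is added to clear them.\<close>
  define r where "r = j mod 16"
  have "r \<in> {..<16}" by (simp add: r_def)
  then have "r \<in> {0, 1, 2, 3, 4, 5, 6, 7, 8, 9, 10, 11, 12, 13, 14, 15}"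
    by (auto simp: lessThan_nat_numeral lessThan_Suc)
  moreover have "j mod 4 = r mod 4" "j mod 8 = r mod 8" by (simp_all add: r_def mod_mod_cancel)
  ultimately have "(j mod 4 = 1 \<or> j mod 4 = 2) \<or> j mod 8 = 3 \<or> j mod 16 = 4 \<or> j mod 16 = 8"
    using j(3) unfolding r_def[symmetric] by auto
  then consider "j mod 4 = 1 \<or> j mod 4 = 2" | "j mod 8 = 3" | "j mod 16 = 4" | "j mod 16 = 8"
    by blast
  then show ?thesis
  proof cases
    case 1
    have "of_nat ((j + 1) choose 2) * axis_entry j = 0"
      using tail[of 1] j by simp
    moreover have "odd ((j + 1) div 2)" using 1 by presburger
    ultimately show ?thesis unfolding coeffs by (simp add: of_nat_bit)
  next
    case 2
    \<comment> \<open>This gives \<open>j + 2 \<le> 2 * j < K\<close>, so the relation with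
      \<open>w = 2\<close> is available. The bound \<open>j \<ge> 4\<close> below plays the same
      part for \<open>w = 4\<close>.\<close>
    then have "j \<ge> 2" by presburger
    then have "of_nat ((j + 3) choose 4) * axis_entry j +
        of_nat ((j + 2) choose 2) * axis_entry (j + 1) = 0"
      using tail[of 2] j by (simp add: lessThan_nat_numeral lessThan_Suc add_ac)
    moreover have "odd ((j + 3) div 4)" "even ((j + 2) div 2)" using 2 by presburger+
    ultimately show ?thesis unfolding coeffs by (simp add: of_nat_bit)
  next
    case 3
    then have "j \<ge> 4" by presburger
    then have "of_nat ((j + 7) choose 8) * axis_entry j +
        of_nat ((j + 6) choose 6) * axis_entry (j + 1) +
        of_nat ((j + 5) choose 4) * axis_entry (j + 2) +
        of_nat ((j + 4) choose 2) * axis_entry (j + 3) = 0"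
      using tail[of 4] j by (simp add: lessThan_nat_numeral lessThan_Suc add_ac)
    moreover obtain t where "j = 16 * t + 4" using 3 by (metis mult_div_mod_eq)
    then have "(j + 7) div 8 = 2 * t + 1" "(j + 6) div 4 = 4 * t + 2" "(j + 5) div 4 = 4 * t + 2"
      "(j + 4) div 2 = 8 * t + 4" by linarith+
    ultimately show ?thesis unfolding coeffs by (simp add: of_nat_bit)
  next
    case 4
    then have "j \<ge> 4" by presburger
    then have "of_nat ((j + 7) choose 8) * axis_entry j +
        of_nat ((j + 6) choose 6) * axis_entry (j + 1) +
        of_nat ((j + 5) choose 4) * axis_entry (j + 2) +
        of_nat ((j + 4) choose 2) * axis_entry (j + 3) = 0"
      using tail[of 4] j by (simp add: lessThan_nat_numeral lessThan_Suc add_ac)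
    moreover have "of_nat ((j + 5) choose 6) * axis_entry j +
        of_nat ((j + 4) choose 4) * axis_entry (j + 1) +
        of_nat ((j + 3) choose 2) * axis_entry (j + 2) = 0"
      using tail[of 3] j \<open>j \<ge> 4\<close> by (simp add: lessThan_nat_numeral lessThan_Suc add_ac)
    moreover obtain t where "j = 16 * t + 8" using 4 by (metis mult_div_mod_eq)
    then have "(j + 7) div 8 = 2 * t + 1" "(j + 6) div 2 = 8 * t + 7" "(j + 6) div 4 = 4 * t + 3"
      "(j + 5) div 4 = 4 * t + 3" "(j + 4) div 2 = 8 * t + 6" "(j + 5) div 2 = 8 * t + 6"
      "(j + 4) div 4 = 4 * t + 3" "(j + 3) div 2 = 8 * t + 5" by linarith+
    ultimately show ?thesis unfolding coeffs by (simp add: of_nat_bit bit_add_eq_0_iff add.assoc)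
  qed
qed

text \<open>Half of row 1 expands in the given entries, and the mirror image covers the other half.
  The top row is then constant off its corners, and its centre shows that the constant is 0.\<close>

lemma zero_if_axis_entries_zero:
  assumes "K \<ge> 1" and zero: "\<And>j. 1 \<le> j \<Longrightarrow> 2 * j < K \<Longrightarrow> axis_entry j = 0"
    and "x + y + z = 2 * K"
  shows "T x y z = 0"
proof -
  have near: "T 1 (2 * K - 2 - q) (1 + q) = 0" if "q + 1 < K \<or> q + 2 = K" "q + 2 < 2 * K" for q
  proof -
    have "T (2 * K - 2 - q) 1 (1 + q) =
        (\<Sum>i<q. of_nat ((q - 1 - i) choose i) * axis_entry (1 + i))"
      using entry_eq_sum_axis_entries[of 1 q] that by simp
    also have "\<dots> = 0"
    proof (intro sum.neutral ballI)
      fix i assume i: "i \<in> {..<q}"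
      show "of_nat ((q - 1 - i) choose i) * axis_entry (1 + i) = 0"
      proof (cases "2 * (1 + i) < K")
        case True
        then show ?thesis using zero[of "1 + i"] by simp
      next
        case False
        \<comment> \<open>Here \<open>K \<le> 2 * (1 + i)\<close> while \<open>q + 1 < K\<close>, so
          the coefficient vanishes.\<close>
        then have "q - 1 - i < i" using that i by auto
        then show ?thesis by (simp add: binomial_eq_0)
      qed
    qed
    finally show ?thesis
      using dihedral_swap12[OF even_dih, of "2 * K - 2 - q" 1 "1 + q"] that by simp
  qed
  have interior: "T 1 y z = 0" if "y \<ge> 1" "z \<ge> 1" "y + z + 1 = 2 * K" for y z
  proof (cases "z < K")
    case True
    moreover have "2 * K - 2 - (z - 1) = y" "1 + (z - 1) = z" using that by simp_all
    ultimately show ?thesis using near[of "z - 1"] that by simp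
  next
    case False
    moreover have "2 * K - 2 - (y - 1) = z" "1 + (y - 1) = y" using that by simp_all
    ultimately have "T 1 z y = 0" using near[of "y - 1"] that by simp
    then show ?thesis using dihedral_swap23[OF even_dih, of 1 y z] that by simp
  qed
  \<comment> \<open>The centre of the top row is out of reach of \<open>dihedral_center\<close>.
    Balancedness at \<open>i = 0\<close> handles it: the other two terms agree by symmetry.\<close>
  have "T 1 0 (2 * K - 1) = T 0 K K + T (2 * K - 1) 0 1"
  proof -
    have "(2 * K - 1 + 1) div 2 = K" "(2 * K - 1 + 2) div 2 = K" using assms(1) by linarith+
    then show ?thesis
      using balanced_row[OF bal, of 0 "2 * K - 1"] assms(1) by simp
  qed
  then have center: "T 0 K K = 0"
    using dihedral_swap13[OF even_dih, of 1 0 "2 * K - 1"] assms(1)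
    by simp
  have const: "T 0 (1 + i) (2 * K - 1 - i) = T 0 1 (2 * K - 1)" if "i + 1 < 2 * K" for i
    using that
  proof (induction i)
    case (Suc i)
    have "T 1 (1 + i) (2 * K - 2 - i) = 0" using Suc.prems by (intro interior) auto
    then have "T 0 (Suc (1 + i)) (2 * K - 2 - i) = T 0 (1 + i) (Suc (2 * K - 2 - i))"
      using dihedral_step[OF even_dih, of 0 "1 + i" "2 * K - 2 - i"] Suc.prems
      by (simp add: bit_add_eq_0_iff)
    moreover have "Suc (2 * K - 2 - i) = 2 * K - 1 - i" "2 * K - 2 - i = 2 * K - 1 - Suc i"
      using Suc.prems by auto
    ultimately show ?case using Suc by simp
  qed simp
  have edge: "T 0 1 (2 * K - 1) = 0"
  proof -
    have "1 + (K - 1) = K" "2 * K - 1 - (K - 1) = K" using assms(1) by auto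
    then show ?thesis using const[of "K - 1"] center assms(1) by simp
  qed
  have corner: "T 0 0 (2 * K) = 0"
    using dihedral_step[OF even_dih, of 0 0 "2 * K - 1"] edge
      dihedral_swap12[OF even_dih, of 1 0 "2 * K - 1"] assms(1) by simp
  have "T 0 y z = 0" if "y + z = 2 * K" for y z
  proof -
    consider "y = 0" | "z = 0" | "y \<ge> 1" "z \<ge> 1" by linarith
    then show ?thesis
    proof cases
      case 1
      then show ?thesis using corner that by simp
    next
      case 2
      then show ?thesis using corner that dihedral_swap23[OF even_dih, of 0 y z] by simp
    next
      case 3
      then have "1 + (y - 1) = y" "2 * K - 1 - (y - 1) = z" using that by auto
      then show ?thesis using const[of "y - 1"] edge 3 that by simp
    qed
  qed
  then show ?thesis using dihedral_zero_if_top_row_zero[OF even_dih] assms(3) by blast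
qed

end

section \<open>Positions that determine a balanced triangle, and their number\<close>

definition determines :: "(nat \<times> nat \<times> nat) set \<Rightarrow> nat \<Rightarrow> bool" where
  "determines P d \<longleftrightarrow>
     (\<forall>T. balanced d T \<and> (\<forall>(x, y, z)\<in>P. T x y z = 0) \<longrightarrow>
        (\<forall>x y z. x + y + z = d \<longrightarrow> T x y z = 0))"

lemma card_free_positions:
  "finite {j. 1 \<le> j \<and> 2 * j < K \<and> j mod 16 \<in> {0, 7, 12, 15}}"
  "card {j. 1 \<le> j \<and> 2 * j < K \<and> j mod 16 \<in> {0, 7, 12, 15}} \<le> K div 8"
proof -
  let ?F = "{j. 1 \<le> j \<and> 2 * j < K \<and> j mod 16 \<in> {0, 7, 12, 15 :: nat}}"
  \<comment> \<open>Division by 5 sends the residues 0, 7, 12, 15 to 0, 1, 2, 3, so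
    \<open>?f\<close> numbers the free positions. Moreover \<open>4 * ?f j \<le> j\<close>, which
    gives the bound.\<close>
  let ?f = "\<lambda>j :: nat. 4 * (j div 16) + (j mod 16) div 5"
  show "finite ?F" by (rule finite_subset[of _ "{..<K}"]) auto
  have "inj_on ?f ?F"
  proof (rule inj_onI)
    fix i j assume ij: "i \<in> ?F" "j \<in> ?F" "?f i = ?f j"
    have "i mod 16 div 5 < 4" "j mod 16 div 5 < 4" using ij by auto
    then have "i div 16 = j div 16" using ij(3) by linarith
    moreover from this have "i mod 16 div 5 = j mod 16 div 5" using ij(3) by simp
    then have "i mod 16 = j mod 16" using ij(1,2) by auto
    ultimately show "i = j" by (metis mult_div_mod_eq)
  qed
  moreover have "?f ` ?F \<subseteq> {1..K div 8}"
  proof (rule image_subsetI)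
    fix j assume "j \<in> ?F"
    then have j: "1 \<le> j" "2 * j < K" and m: "j mod 16 \<in> {0, 7, 12, 15}" by auto
    have "4 * (j mod 16 div 5) \<le> j mod 16" "j mod 16 = 0 \<or> j mod 16 div 5 \<ge> 1"
      using m by auto
    moreover have "16 * (j div 16) + j mod 16 = j" by simp
    ultimately have "1 \<le> ?f j" "4 * ?f j \<le> j" using j(1) unfolding add_mult_distrib2 by linarith+
    then have "1 \<le> ?f j" "8 * ?f j \<le> K" using j(2) by linarith+
    then show "?f j \<in> {1..K div 8}"
      unfolding atLeastAtMost_iff by (simp only: less_eq_div_iff_mult_less_eq zero_less_numeral mult.commute)
  qed
  ultimately show "card ?F \<le> K div 8"
    using card_inj_on_le[of ?f ?F "{1..K div 8}"] by simp
qed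

lemma determines_even:
  assumes "K \<ge> 1"
  shows "determines
    ((\<lambda>j. (2 * K - 2 * j - 1, j, j + 1)) ` {j. 1 \<le> j \<and> 2 * j < K \<and> j mod 16 \<in> {0, 7, 12, 15}})
    (2 * K)"
  unfolding determines_def
proof (intro allI impI)
  fix T :: "nat \<Rightarrow> nat \<Rightarrow> nat \<Rightarrow> bit" and x y z :: nat
  assume T: "balanced (2 * K) T \<and> (\<forall>(x, y, z)\<in>(\<lambda>j. (2 * K - 2 * j - 1, j, j + 1)) `
      {j. 1 \<le> j \<and> 2 * j < K \<and> j mod 16 \<in> {0, 7, 12, 15}}. T x y z = 0)"
    and s: "x + y + z = 2 * K"
  have free: "axis_entry K T j = 0"
    if "1 \<le> j" "2 * j < K" "j mod 16 \<in> {0, 7, 12, 15}" for j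
    using T that by (auto simp: axis_entry_def)
  have "axis_entry K T j = 0" if "1 \<le> j" "2 * j < K" for j
    using that
  proof (induction j rule: less_induct)
    case (less j)
    then show ?case using free[of j] axis_entry_zero[of K T j] T
      by (cases "j mod 16 \<in> {0, 7, 12, 15}") auto
  qed
  then show "T x y z = 0" using T s assms by (intro zero_if_axis_entries_zero[of K T]) auto
qed

text \<open>The map lists the positions where \<open>halved\<close> reads \<open>T\<close>, so the
  number of parameters does not grow.\<close>

lemma determines_odd:
  assumes "determines P (h + 1)"
  shows "determines ((\<lambda>(x, y, z). if x > 0 then (2 * x - 1, 2 * y, 2 * z)
    else if y > 0 then (2 * x, 2 * y - 1, 2 * z) else (2 * x, 2 * y, 2 * z - 1)) ` P) (2 * h + 1)"
    (is "determines (?f ` P) _")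
  unfolding determines_def
proof (intro allI impI)
  fix T :: "nat \<Rightarrow> nat \<Rightarrow> nat \<Rightarrow> bit" and x y z :: nat
  assume T: "balanced (2 * h + 1) T \<and> (\<forall>(x, y, z)\<in>?f ` P. T x y z = 0)"
    and s: "x + y + z = 2 * h + 1"
  have "halved T x y z = 0" if "(x, y, z) \<in> P" for x y z
  proof -
    have "\<forall>p\<in>P. case ?f p of (x, y, z) \<Rightarrow> T x y z = 0" using T by simp
    from bspec[OF this that] show ?thesis
      by (cases "x > 0"; cases "y > 0") (simp_all add: halved_def)
  qed
  then have "halved T x y z = 0" if "x + y + z = h + 1" for x y z
    using assms balanced_halved[of h T] T that unfolding determines_def by auto
  then show "T x y z = 0" using zero_if_halved_zero[of h T] T s by blast
qed

text \<open>Degree 1 is the fixed point of the passage from \<open>2 * h + 1\<close> to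
  \<open>h + 1\<close>.\<close>

lemma determines_one: "determines {} 1"
  unfolding determines_def
proof (intro allI impI)
  fix T :: "nat \<Rightarrow> nat \<Rightarrow> nat \<Rightarrow> bit" and x y z :: nat
  assume T: "balanced 1 T \<and> (\<forall>(x, y, z)\<in>{}. T x y z = 0)" and s: "x + y + z = 1"
  have dih: "dihedral 1 T" using T balanced_dihedral by blast
  have "T 1 0 0 = 0" using T balanced_row[of 1 T 0 0] by simp
  then have "T 0 1 0 = 0" "T 0 0 1 = 0"
    using dihedral_swap12[OF dih, of 1 0 0] dihedral_swap13[OF dih, of 1 0 0] by simp_all
  then have "T 0 y z = 0" if "y + z = 1" for y z
    using that by (cases y) auto
  then show "T x y z = 0" using dihedral_zero_if_top_row_zero[OF dih] s by blast
qed

lemma ex_small_determining_set: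
  assumes "d \<ge> 1"
  shows "\<exists>P. finite P \<and> card P \<le> d div 16 \<and> determines P d"
  using assms
proof (induction d rule: less_induct)
  case (less d)
  consider K where "d = 2 * K" | "d = 1" | h where "d = 2 * h + 1" "h \<ge> 1"
  proof (cases "even d")
    case False
    then obtain h where "d = 2 * h + 1" by (rule oddE)
    then show ?thesis using that(2) that(3)[of h] by (cases "h = 0") auto
  qed (use that(1) in \<open>auto elim!: evenE\<close>)
  then show ?case
  proof cases
    case (1 K)
    define F where "F = {j. 1 \<le> j \<and> 2 * j < K \<and> j mod 16 \<in> {0, 7, 12, 15}}"
    let ?P = "(\<lambda>j. (2 * K - 2 * j - 1, j, j + 1)) ` F"
    have F: "finite F" "card F \<le> K div 8" unfolding F_def by (rule card_free_positions)+
    have "d div 16 = K div 8" using 1 by simp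
    then have "card ?P \<le> d div 16"
      using card_image_le[OF F(1), of "\<lambda>j. (2 * K - 2 * j - 1, j, j + 1)"] F(2) by linarith
    moreover have "determines ?P d"
      using determines_even[of K] 1 less.prems unfolding F_def by simp
    ultimately show ?thesis using F(1) by blast
  next
    case 2
    then show ?thesis using determines_one by (intro exI[of _ "{}"]) simp
  next
    case (3 h)
    then obtain P where P: "finite P" "card P \<le> (h + 1) div 16" "determines P (h + 1)"
      using less.IH[of "h + 1"] by auto
    have "(h + 1) div 16 \<le> d div 16" using 3 by (intro div_le_mono) auto
    with determines_odd[OF P(3)] P(1,2) card_image_le[OF P(1)] 3(1) show ?thesis
      by (meson finite_imageI le_trans)
  qed
qed

section \<open>Steinhaus matrices as triangles\<close>

text \<open>With indices from 0, \<open>x\<close>, \<open>y\<close>, \<open>z\<close> count the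
  indices before the row, strictly between row and column, and after the column.\<close>

definition triangle :: "bit mat \<Rightarrow> nat \<Rightarrow> nat \<Rightarrow> nat \<Rightarrow> bit" where
  "triangle M x y z = M $$ (x, x + y + 1)"

text \<open>Multi-symmetry reflects a row and swaps \<open>y\<close> with \<open>z\<close>;
  reflection in the antidiagonal swaps \<open>x\<close> with \<open>z\<close>. These generate all
  permutations.\<close>

lemma dihedral_triangle:
  assumes "steinhaus_matrix (d + 2) M" "multi_symmetric (d + 2) M"
  shows "dihedral d (triangle M)"
proof -
  have step: "triangle M (Suc x) y z = triangle M x (Suc y) z + triangle M x y (Suc z)"
    if "x + y + z + 1 = d" for x y z
  proof -
    have "2 \<le> x + 2" "x + 2 < x + y + 3" "x + y + 3 \<le> d + 2" using that by auto
    then have "ent M (x + 2) (x + y + 3) =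
        ent M (x + 2 - 1) (x + y + 3 - 1) + ent M (x + 2 - 1) (x + y + 3)"
      using assms(1) unfolding steinhaus_matrix_def by blast
    then show ?thesis by (simp add: triangle_def numeral_2_eq_2 numeral_3_eq_3 add.commute)
  qed
  have swap23: "triangle M x y z = triangle M x z y" if "x + y + z = d" for x y z
  proof -
    have "1 \<le> x + 1" "x + 1 < x + y + 2" "x + y + 2 \<le> d + 2" using that by auto
    then have "ent M (x + 1) (x + y + 2) = ent M (x + 1) (d + 2 - (x + y + 2) + (x + 1) + 1)"
      using assms(2) unfolding multi_symmetric_def by blast
    moreover have "d + 2 - (x + y + 2) + (x + 1) + 1 = x + z + 2" using that by simp
    ultimately show ?thesis by (simp add: triangle_def add_ac)
  qed
  have swap13: "triangle M x y z = triangle M z y x" if "x + y + z = d" for x y z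
  proof -
    have "x + 1 \<in> {1..d + 2}" "x + y + 2 \<in> {1..d + 2}" using that by auto
    then have "ent M (x + 1) (x + y + 2) = ent M (x + y + 2) (x + 1) \<and>
        ent M (x + y + 2) (x + 1) = ent M (d + 2 - (x + y + 2) + 1) (d + 2 - (x + 1) + 1)"
      using assms(2) unfolding multi_symmetric_def doubly_symmetric_def by blast
    then have "ent M (x + 1) (x + y + 2) =
        ent M (d + 2 - (x + y + 2) + 1) (d + 2 - (x + 1) + 1)"
      by (rule conjE) (rule trans)
    moreover have "d + 2 - (x + y + 2) + 1 = z + 1" "d + 2 - (x + 1) + 1 = z + y + 2"
      using that by auto
    ultimately show ?thesis by (simp add: triangle_def)
  qed
  have "triangle M x y z = triangle M y x z" if "x + y + z = d" for x y z
    using swap23[of x y z] swap13[of x z y] swap23[of y z x] that by simp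
  with step swap23 show ?thesis unfolding dihedral_def by blast
qed

lemma triangle_determines_matrix:
  assumes "steinhaus_matrix (d + 2) M" "steinhaus_matrix (d + 2) M'"
    and eq: "\<And>x y z. x + y + z = d \<Longrightarrow> triangle M x y z = triangle M' x y z"
  shows "M = M'"
proof -
  have upper: "M $$ (i, j) = M' $$ (i, j)" if "i < j" "j < d + 2" for i j
  proof -
    have "i + (j - i - 1) + (d + 1 - j) = d" "i + (j - i - 1) + 1 = j" using that by auto
    with eq[of i "j - i - 1" "d + 1 - j"] show ?thesis by (simp add: triangle_def)
  qed
  have diag: "N $$ (i, i) = 0" if "steinhaus_matrix (d + 2) N" "i < d + 2" for N i
    using that unfolding steinhaus_matrix_def by (auto dest: bspec[of _ _ "i + 1"])
  have symm: "N $$ (i, j) = N $$ (j, i)"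
    if "steinhaus_matrix (d + 2) N" "i < d + 2" "j < d + 2" for N i j
  proof -
    have "i + 1 \<in> {1..d + 2}" "j + 1 \<in> {1..d + 2}" using that by auto
    then have "ent N (i + 1) (j + 1) = ent N (j + 1) (i + 1)"
      using that(1) unfolding steinhaus_matrix_def by blast
    then show ?thesis by simp
  qed
  have "M \<in> carrier_mat (d + 2) (d + 2)" "M' \<in> carrier_mat (d + 2) (d + 2)"
    using assms(1,2) unfolding steinhaus_matrix_def by blast+
  then show ?thesis
  proof (intro eq_matI)
    fix i j assume "i < dim_row M'" "j < dim_col M'"
    then have ij: "i < d + 2" "j < d + 2" using \<open>M' \<in> _\<close> by auto
    consider "i < j" | "i = j" | "j < i" by linarith
    then show "M $$ (i, j) = M' $$ (i, j)"
    proof cases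
      case 1
      then show ?thesis using upper ij by simp
    next
      case 2
      then show ?thesis using diag assms(1,2) ij by simp
    next
      case 3
      then show ?thesis using upper[of j i] symm[OF assms(1) ij] symm[OF assms(2) ij] ij by simp
    qed
  qed auto
qed

section \<open>Row sums and vertex degrees\<close>

text \<open>At \<open>x = d + 1\<close> the row is empty and the weight 0, which serves the first
  and last vertices.\<close>

definition row_weight :: "nat \<Rightarrow> (nat \<Rightarrow> nat \<Rightarrow> nat \<Rightarrow> bit) \<Rightarrow> nat \<Rightarrow> nat" where
  "row_weight d T x = card {y. y < d + 1 - x \<and> T x y (d - x - y) = 1}"

lemma card_palindrome:
  fixes P :: "nat \<Rightarrow> bool"
  assumes sym: "\<And>y. y < l \<Longrightarrow> P y = P (l - 1 - y)" and mid: "odd l \<Longrightarrow> \<not> P (l div 2)"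
  shows "card {y. y < l \<and> P y} = 2 * card {y. y < l div 2 \<and> P y}"
proof -
  let ?A = "{y. y < l div 2 \<and> P y}" and ?r = "\<lambda>y. l - 1 - y"
  have "{y. y < l \<and> P y} = ?A \<union> ?r ` ?A"
  proof (intro equalityI subsetI)
    fix y assume y: "y \<in> {y. y < l \<and> P y}"
    then have "\<not> (odd l \<and> y = l div 2)" using mid by auto
    then have "y < l div 2 \<or> l - 1 - y < l div 2"
      using y mod_less_divisor[of 2 l] div_mult_mod_eq[of l 2] by (auto simp: odd_iff_mod_2_eq_one)
    then consider "y < l div 2" | "l - 1 - y < l div 2" by blast
    then show "y \<in> ?A \<union> ?r ` ?A"
    proof cases
      case 2
      then have "l - 1 - y \<in> ?A" "?r (l - 1 - y) = y" using y sym[of y] by auto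
      then show ?thesis by (metis UnI2 imageI)
    qed (use y in auto)
  next
    fix y assume "y \<in> ?A \<union> ?r ` ?A"
    then consider "y \<in> ?A" | x where "x \<in> ?A" "y = ?r x" by blast
    then show "y \<in> {y. y < l \<and> P y}"
    proof cases
      case (2 x)
      then have "x < l" by auto
      with 2 sym[OF \<open>x < l\<close>] show ?thesis by auto
    qed auto
  qed
  moreover have "?A \<inter> ?r ` ?A = {}" by auto
  moreover have "card (?r ` ?A) = card ?A"
    by (rule card_image) (auto simp: inj_on_def)
  ultimately show ?thesis by (simp add: card_Un_disjoint)
qed

lemma of_nat_card_ones:
  fixes g :: "nat \<Rightarrow> bit"
  shows "of_nat (card {y. y < m \<and> g y = 1}) = (\<Sum>y<m. g y)"
proof (induction m)
  case (Suc m)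
  have "{y. y < Suc m \<and> g y = 1} =
      (if g m = 1 then insert m {y. y < m \<and> g y = 1} else {y. y < m \<and> g y = 1})"
    by (auto simp: less_Suc_eq)
  with Suc show ?case by (cases "g m") (auto simp: add.commute)
qed simp

text \<open>Each entry is the sum of two neighbours above it, so the sum telescopes modulo
  2.\<close>

lemma sum_row_prefix:
  assumes "dihedral d T" "i + k + 1 = d" "m \<le> k + 1"
  shows "(\<Sum>y<m. T (Suc i) y (k - y)) = T i m (k + 1 - m) + T i 0 (k + 1)"
  using assms(3)
proof (induction m)
  case (Suc m)
  have "T (Suc i) m (k - m) = T i (Suc m) (k - m) + T i m (Suc (k - m))"
    using assms(2) Suc.prems by (intro dihedral_step[OF assms(1)]) auto
  moreover have "Suc (k - m) = k + 1 - m" using Suc.prems by simp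
  ultimately show ?case using Suc by (simp add: add_ac)
qed simp

text \<open>The constant \<open>c\<close> drops out: the condition for \<open>i = k\<close> already shows that it is divisible by 4.\<close>

lemma balanced_if_row_weights:
  assumes dih: "dihedral (2 * h + 1) T"
    and cong: "\<And>i k. i + k = 2 * h \<Longrightarrow>
      [row_weight (2 * h + 1) T (i + 1) + row_weight (2 * h + 1) T (k + 1) = c] (mod 4)"
  shows "balanced (2 * h + 1) T"
proof -
  let ?d = "2 * h + 1"
  let ?\<gamma> = "\<lambda>i k. T i ((k + 1) div 2) ((k + 2) div 2)"
  define s where "s i k = card {y. y < (k + 1) div 2 \<and> T (i + 1) y (k - y) = 1}" for i k
  have weight: "row_weight ?d T (i + 1) = 2 * s i k" if "i + k = 2 * h" for i k
  proof -
    have "card {y. y < k + 1 \<and> T (i + 1) y (k - y) = 1} = 2 * s i k"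
      unfolding s_def
    proof (rule card_palindrome)
      fix y assume "y < k + 1"
      then show "(T (i + 1) y (k - y) = 1) = (T (i + 1) (k + 1 - 1 - y) (k - (k + 1 - 1 - y)) = 1)"
        using dihedral_swap23[OF dih, of "i + 1" y "k - y"] that by simp
    next
      assume "odd (k + 1)"
      then have "(k + 1) div 2 = k div 2" "k - k div 2 = k div 2" "k div 2 + k div 2 = k" by auto
      then show "\<not> T (i + 1) ((k + 1) div 2) (k - (k + 1) div 2) = 1"
        using dihedral_center[OF dih, of "i + 1" "k div 2"] that by simp
    qed
    moreover have "?d + 1 - (i + 1) = k + 1" "?d - (i + 1) = k" using that by auto
    ultimately show ?thesis by (simp add: row_weight_def)
  qed
  have half: "of_nat (s i k) = ?\<gamma> i k + T i 0 (k + 1)" if "i + k = 2 * h" for i k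
  proof -
    have "of_nat (s i k) = (\<Sum>y<(k + 1) div 2. T (Suc i) y (k - y))"
      unfolding s_def by (simp add: of_nat_card_ones)
    moreover have "k + 1 - (k + 1) div 2 = (k + 2) div 2" by linarith
    ultimately show ?thesis
      using sum_row_prefix[OF dih, of i k "(k + 1) div 2"] that by simp
  qed
  have even: "(of_nat (s i k + s k i) :: bit) = 0" if "i + k = 2 * h" for i k
  proof -
    have "[2 * s i k + 2 * s k i = 2 * s h h + 2 * s h h] (mod 4)"
      using cong[OF that] cong[of k i] cong[of h h] weight[OF that] weight[of k i] weight[of h h] that
      by (simp add: add.commute) (metis cong_sym cong_trans)
    then have "(2 * s i k + 2 * s k i) mod 4 = 0"
      unfolding cong_def by simp
    then have "even (s i k + s k i)" by presburger
    then show ?thesis by (simp only: of_nat_bit) simp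
  qed
  have sum0: "?\<gamma> i k + T i 0 (k + 1) + (?\<gamma> k i + T k 0 (i + 1)) = 0"
    if "i + k = 2 * h" for i k
    using even[OF that] half[OF that] half[of k i] that
    by (simp only: of_nat_add add.commute[of k i])
  show ?thesis
    unfolding balanced_def
  proof (intro conjI allI impI dih)
    fix i k assume "i + k + 1 = ?d"
    then have ik: "i + k = 2 * h" by simp
    \<comment> \<open>The two row ends left by telescoping differ exactly by
      \<open>T 1 i k\<close>.\<close>
    have "T k 0 (i + 1) = T (Suc i) 0 k"
      using dihedral_swap13[OF dih, of k 0 "i + 1"] ik by simp
    also have "\<dots> = T i 1 k + T i 0 (k + 1)"
      using dihedral_step[OF dih, of i 0 k] ik by simp
    also have "T i 1 k = T 1 i k"
      using dihedral_swap12[OF dih, of i 1 k] ik by simp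
    finally have "?\<gamma> i k + T i 0 (k + 1) + (?\<gamma> k i + (T 1 i k + T i 0 (k + 1))) = 0"
      using sum0[OF ik] by simp
    then have "T 1 i k + (?\<gamma> i k + ?\<gamma> k i) = 0" by (simp add: add_ac)
    then show "T 1 i k = ?\<gamma> i k + ?\<gamma> k i" by (simp only: bit_add_eq_0_iff)
  qed
qed

text \<open>Right of the diagonal lies row \<open>i\<close> of the triangle. Left of it lies, after
  transposition, the line \<open>z = d + 1 - i\<close>, which symmetry turns into a row.\<close>

lemma out_degree_steinhaus_graph:
  assumes M: "steinhaus_matrix (d + 2) M" "multi_symmetric (d + 2) M" and i: "i < d + 2"
  shows "out_degree (with_proj (steinhaus_graph (d + 2) M)) (i + 1) =
    row_weight d (triangle M) i + row_weight d (triangle M) (d + 1 - i)"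
proof -
  note dih = dihedral_triangle[OF M]
  have diag: "M $$ (i, i) = 0"
    using M(1) i unfolding steinhaus_matrix_def by (auto dest: bspec[of _ _ "i + 1"])
  have symm: "M $$ (i, j) = M $$ (j, i)" if "j < d + 2" for j
  proof -
    have "i + 1 \<in> {1..d + 2}" "j + 1 \<in> {1..d + 2}" using that i by auto
    then have "ent M (i + 1) (j + 1) = ent M (j + 1) (i + 1)"
      using M(1) unfolding steinhaus_matrix_def by blast
    then show ?thesis by simp
  qed
  let ?G = "with_proj (steinhaus_graph (d + 2) M)"
  let ?L = "{j. j < i \<and> M $$ (i, j) = 1}" and ?R = "{j. i < j \<and> j < d + 2 \<and> M $$ (i, j) = 1}"
  have "out_arcs ?G (i + 1) = (\<lambda>j. (i + 1, j + 1)) ` (?L \<union> ?R)"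
  proof (intro equalityI subsetI)
    fix e assume "e \<in> out_arcs ?G (i + 1)"
    then obtain j where e: "e = (i + 1, j)" "j \<in> {1..d + 2}" "M $$ (i, j - 1) = 1"
      by (auto simp: out_arcs_def steinhaus_graph_def)
    then have "j - 1 \<noteq> i" using diag by auto
    then have "j - 1 \<in> ?L \<union> ?R" "e = (i + 1, j - 1 + 1)" using e by auto
    then show "e \<in> (\<lambda>j. (i + 1, j + 1)) ` (?L \<union> ?R)" by blast
  qed (use i in \<open>auto simp: out_arcs_def steinhaus_graph_def\<close>)
  then have "out_degree ?G (i + 1) = card (?L \<union> ?R)"
    unfolding out_degree_def by (simp add: card_image inj_on_def)
  also have "\<dots> = card ?R + card ?L" by (subst card_Un_disjoint) auto
  also have "card ?L = row_weight d (triangle M) (d + 1 - i)"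
  proof -
    have "M $$ (i, j) = triangle M (d + 1 - i) j (i - 1 - j)" if "j < i" for j
    proof -
      have "M $$ (i, j) = triangle M j (i - 1 - j) (d + 1 - i)"
        using symm[of j] that i by (simp add: triangle_def)
      also have "\<dots> = triangle M (d + 1 - i) (i - 1 - j) j"
        using that i by (intro dihedral_swap13[OF dih]) auto
      also have "\<dots> = triangle M (d + 1 - i) j (i - 1 - j)"
        using that i by (intro dihedral_swap23[OF dih]) auto
      finally show ?thesis .
    qed
    then have "?L = {j. j < i \<and> triangle M (d + 1 - i) j (i - 1 - j) = 1}" by auto
    moreover have "d + 1 - (d + 1 - i) = i" "d - (d + 1 - i) = i - 1" using i by auto
    ultimately show ?thesis by (simp add: row_weight_def)
  qed
  also have "card ?R = row_weight d (triangle M) i"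
  proof -
    have "?R = (\<lambda>y. i + y + 1) ` {y. y < d + 1 - i \<and> triangle M i y (d - i - y) = 1}"
    proof (intro equalityI subsetI)
      fix j assume "j \<in> ?R"
      then have "j - i - 1 \<in> {y. y < d + 1 - i \<and> triangle M i y (d - i - y) = 1}"
        "j = i + (j - i - 1) + 1" by (auto simp: triangle_def)
      then show "j \<in> (\<lambda>y. i + y + 1) ` {y. y < d + 1 - i \<and> triangle M i y (d - i - y) = 1}"
        by blast
    qed (auto simp: triangle_def)
    then show ?thesis by (simp add: row_weight_def card_image inj_on_def)
  qed
  finally show ?thesis .
qed

lemma balanced_triangle:
  assumes M: "steinhaus_matrix (2 * h + 3) M" "multi_symmetric (2 * h + 3) M"
    and reg: "regular_modulo 4 (steinhaus_graph (2 * h + 3) M)"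
  shows "balanced (2 * h + 1) (triangle M)"
proof (rule balanced_if_row_weights)
  let ?d = "2 * h + 1" and ?G = "steinhaus_graph (2 * h + 3) M"
  have n: "2 * h + 3 = ?d + 2" by simp
  note M' = M[unfolded n]
  show "dihedral ?d (triangle M)" using M' by (rule dihedral_triangle)
  fix i k assume ik: "i + k = 2 * h"
  \<comment> \<open>The degree of the first vertex serves as the constant \<open>c\<close>.\<close>
  have "i + 1 + 1 \<in> pverts ?G" "1 \<in> pverts ?G" using ik by (auto simp: steinhaus_graph_def)
  then have "[out_degree (with_proj ?G) (i + 1 + 1) = out_degree (with_proj ?G) 1] (mod 4)"
    using reg unfolding regular_modulo_def by blast
  moreover have "?d + 1 - (i + 1) = k + 1" using ik by simp
  ultimately show "[row_weight ?d (triangle M) (i + 1) + row_weight ?d (triangle M) (k + 1) =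
      out_degree (with_proj ?G) 1] (mod 4)"
    using out_degree_steinhaus_graph[OF M', of "i + 1"] ik unfolding n by simp
qed

section \<open>Counting by subsets of a determining set\<close>

theorem theorem6:
  fixes n :: nat
  assumes "odd n"
  shows "finite {M. steinhaus_matrix n M \<and> multi_symmetric n M \<and>
                    regular_modulo 4 (steinhaus_graph n M)} \<and>
         card {M. steinhaus_matrix n M \<and> multi_symmetric n M \<and>
                 regular_modulo 4 (steinhaus_graph n M)} \<le> 2 ^ nat \<lceil>real n / 30\<rceil>"
proof -
  let ?S = "{M. steinhaus_matrix n M \<and> multi_symmetric n M \<and> regular_modulo 4 (steinhaus_graph n M)}"
  obtain P :: "(nat \<times> nat \<times> nat) set"
    where P: "finite P" "card P \<le> nat \<lceil>real n / 30\<rceil>"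
      and inj: "inj_on (\<lambda>M. {(x, y, z) \<in> P. triangle M x y z = 1}) ?S"
  proof (cases "n = 1")
    case True
    have "M = M'" if "steinhaus_matrix 1 M" "steinhaus_matrix 1 M'" for M M'
      using that by (intro eq_matI) (auto simp: steinhaus_matrix_def)
    then show ?thesis using True by (intro that[of "{}"]) (auto simp: inj_on_def)
  next
    case False
    from assms obtain m where "n = 2 * m + 1" by (rule oddE)
    with False have "n = 2 * (m - 1) + 3" by simp
    then obtain h where n: "n = 2 * h + 3" by blast
    \<comment> \<open>The bound is taken at degree \<open>h + 1\<close> and transferred to
      \<open>2 * h + 1\<close>, which halves the count available at the larger degree.\<close>
    obtain Q where Q: "finite Q" "card Q \<le> (h + 1) div 16" "determines Q (h + 1)"
      using ex_small_determining_set[of "h + 1"] by auto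
    then obtain P where P: "finite P" "card P \<le> card Q" "determines P (2 * h + 1)"
      using determines_odd[OF Q(3)] card_image_le[OF Q(1)] by (meson finite_imageI)
    \<comment> \<open>From \<open>16 * card P \<le> h + 1\<close> even
      \<open>32 * card P < n\<close> follows.\<close>
    have "30 * card P \<le> n" using P(2) Q(2) n by linarith
    then have "card P \<le> nat \<lceil>real n / 30\<rceil>" by linarith
    moreover have "inj_on (\<lambda>M. {(x, y, z) \<in> P. triangle M x y z = 1}) ?S"
    proof (rule inj_onI)
      fix M M' assume M: "M \<in> ?S" "M' \<in> ?S"
        and eq: "{(x, y, z) \<in> P. triangle M x y z = 1} = {(x, y, z) \<in> P. triangle M' x y z = 1}"
      \<comment> \<open>By linearity the sum is balanced, and it vanishes on \<open>P\<close>, hence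
        everywhere.\<close>
      let ?D = "\<lambda>x y z. triangle M x y z + triangle M' x y z"
      have n': "2 * h + 1 + 2 = n" using n by simp
      have st: "steinhaus_matrix (2 * h + 1 + 2) M" "steinhaus_matrix (2 * h + 1 + 2) M'"
        using M unfolding n' by auto
      have "balanced (2 * h + 1) ?D"
        using M unfolding n by (intro balanced_add balanced_triangle) auto
      moreover have "\<forall>(x, y, z)\<in>P. ?D x y z = 0"
      proof (clarify)
        fix x y z assume "(x, y, z) \<in> P"
        then have "triangle M x y z = 1 \<longleftrightarrow> triangle M' x y z = 1" using eq by blast
        then show "?D x y z = 0" by (cases "triangle M x y z"; cases "triangle M' x y z") simp_all
      qed
      ultimately have "\<forall>x y z. x + y + z = 2 * h + 1 \<longrightarrow> ?D x y z = 0"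
        using P(3) unfolding determines_def by blast
      then show "M = M'"
        by (intro triangle_determines_matrix[OF st]) (simp add: bit_add_eq_0_iff)
    qed
    ultimately show ?thesis using P(1) that by blast
  qed
  have "(\<lambda>M. {(x, y, z) \<in> P. triangle M x y z = 1}) ` ?S \<subseteq> Pow P" "finite (Pow P)"
    using P(1) by auto
  then have "finite ?S" "card ?S \<le> card (Pow P)"
    by (rule inj_on_finite[OF inj], rule card_inj_on_le[OF inj])
  moreover have "card (Pow P) \<le> 2 ^ nat \<lceil>real n / 30\<rceil>"
    using P by (simp add: card_Pow)
  ultimately show ?thesis by simp
qed

end
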